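(* Let $\epsilon\in\mathbb{R}$. Suppose that in the quantum winning strategy for the Mermin-GHZ game Alice (player 1) performs the unitary transformation $U$ imperfectly with systematic error $\epsilon$ (i.e. she applies $U_\epsilon$ in place of $U$), all other steps being performed correctly. Then for any inputs $x_1,x_2,x_3\in\{0,1\}$ satisfying the promise $x_1\oplus x_2\oplus x_3=0$, the strategy gives a correct answer with probability $$P_{\epsilon}(x_1,x_2,x_3)=\begin{cases}1 & \text{if } x_1=0,\\ \dfrac{1+\cos\epsilon}{2} & \text{otherwise.}\end{cases}$$ Moreover, for a question $(x_1,x_2,x_3)$ chosen uniformly at random from the promise set $P$, it gives a correct answer with probability $$P_{\epsilon}=\frac12+\frac{1+\cos\epsilon}{4}.$$
   Context: Mermin-GHZ game: three players, Alice, Bob and Charles (players 1, 2, 3), receive input bits $x_1,x_2,x_3\in\{0,1\}$ respectively, with the promise that $(x_1,x_2,x_3)\in P=\{(x_1,x_2,x_3)\in\{0,1\}^3 : x_1\oplus x_2\oplus x_3=0\}$. Without communicating, they output bits $a_1,a_2,a_3$ respectively. The answer is correct if $a_1\oplus a_2\oplus a_3=x_1\lor x_2\lor x_3$. Quantum winning strategy: the players share the three-qubit state $|\varphi\rangle=\frac{1}{\sqrt2}(|000\rangle+|111\rangle)$, player $i$ holding the $i$-th qubit. On input $x_i$, player $i$ (1) applies to his or her qubit the unitary $U$ given by $U|0\rangle=|0\rangle$, $U|1\rangle=e^{\pi \imath x_i/2}|1\rangle$; (2) applies the Hadamard transformation $H=\frac{1}{\sqrt2}\begin{pmatrix}1&1\\1&-1\end{pmatrix}$;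 (3) measures the qubit in the computational basis and outputs the measured bit $a_i$. Here $\imath$ is the imaginary unit. Systematic error $\epsilon$ in Alice's transformation $U$: $\epsilon$ is a constant and Alice applies, in step (1), instead of $U$ the unitary $U_\epsilon$ given by $U_\epsilon|0\rangle=|0\rangle$, $U_\epsilon|1\rangle=e^{(\frac{\pi}{2}+\epsilon)\imath x_1}|1\rangle$; everything else is unchanged. *)

theory Defs
  imports "HOL-Probability.Probability"
begin

text \<open>
  Bits are booleans (\<open>False\<close> is 0, \<open>True\<close> is 1), so exclusive or on bits is \<open>\<noteq>\<close>.
  A qubit is a vector in \<open>complex ^ bool\<close>, and a system composed of parts with basis index
  types \<open>'a\<close> and \<open>'b\<close> has basis index type \<open>'a \<times> 'b\<close>.
\<close>

type_synonym bits3 = "bool \<times> bool \<times> bool"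

abbreviation xor_bit :: "bool \<Rightarrow> bool \<Rightarrow> bool" (infixl "\<oplus>" 65)
  where "a \<oplus> b \<equiv> a \<noteq> b"

definition promise :: "bits3 set"
  where "promise = {(x1, x2, x3). (x1 \<oplus> x2 \<oplus> x3) = False}"

definition correct :: "bits3 \<Rightarrow> bits3 \<Rightarrow> bool"
  where "correct = (\<lambda>(x1, x2, x3) (a1, a2, a3). (a1 \<oplus> a2 \<oplus> a3) = (x1 \<or> x2 \<or> x3))"

definition ket :: "'n::finite \<Rightarrow> complex ^ 'n"
  where "ket b = axis b 1"

definition tensor_op ::
    "complex ^ 'a ^ 'a \<Rightarrow> complex ^ 'b ^ 'b \<Rightarrow> complex ^ ('a::finite \<times> 'b::finite) ^ ('a \<times> 'b)"
    (infixr "\<otimes>" 70)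
  where "A \<otimes> B = (\<chi> i j. A $ fst i $ fst j * B $ snd i $ snd j)"

definition ghz :: "complex ^ bits3"
  where "ghz = (1 / sqrt 2) *\<^sub>R (ket (False, False, False) + ket (True, True, True))"

definition hadamard :: "complex ^ bool ^ bool"
  where "hadamard = (\<chi> i j. (if i \<and> j then - 1 else 1) / of_real (sqrt 2))"

definition phase_op :: "complex \<Rightarrow> complex ^ bool ^ bool"
  where "phase_op z = (\<chi> i j. if i \<noteq> j then 0 else if i then z else 1)"

definition U_exact :: "bool \<Rightarrow> complex ^ bool ^ bool"
  where "U_exact x = phase_op (exp (of_real pi * \<i> * of_bool x / 2))"

definition U_err :: "real \<Rightarrow> bool \<Rightarrow> complex ^ bool ^ bool"
  where "U_err \<epsilon> x = phase_op (exp (of_real (pi / 2 + \<epsilon>) * \<i> * of_bool x))"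

definition final_state :: "real \<Rightarrow> bits3 \<Rightarrow> complex ^ bits3"
  where "final_state \<epsilon> = (\<lambda>(x1, x2, x3).
    (hadamard \<otimes> hadamard \<otimes> hadamard) *v
      ((U_err \<epsilon> x1 \<otimes> U_exact x2 \<otimes> U_exact x3) *v ghz))"

text \<open>
  Born rule for a measurement in the computational basis; \<open>embed_pmf\<close> is meaningful here
  because the measured states are unit vectors (see \<open>pmf_measure_state\<close> and
  \<open>norm_final_state\<close>).
\<close>

definition measure_state :: "complex ^ 'n::finite \<Rightarrow> 'n pmf"
  where "measure_state \<psi> = embed_pmf (\<lambda>b. (cmod (\<psi> $ b))\<^sup>2)"

definition strategy_output :: "real \<Rightarrow> bits3 \<Rightarrow> bits3 pmf"
  where "strategy_output \<epsilon> x = measure_state (final_state \<epsilon> x)"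

definition random_game :: "real \<Rightarrow> (bits3 \<times> bits3) pmf"
  where "random_game \<epsilon> = do {
    x \<leftarrow> pmf_of_set promise;
    a \<leftarrow> strategy_output \<epsilon> x;
    return_pmf (x, a)
  }"

lemma pmf_measure_state:
  assumes "norm \<psi> = 1"
  shows "pmf (measure_state \<psi>) b = (cmod (\<psi> $ b))\<^sup>2"
proof -
  have s: "(\<Sum>b\<in>UNIV. (cmod (\<psi> $ b))\<^sup>2) = 1"
    using assms by (simp add: norm_vec_def L2_set_def)
  have "(\<integral>\<^sup>+ b. ennreal ((cmod (\<psi> $ b))\<^sup>2) \<partial>count_space UNIV) = 1"
    by (simp add: nn_integral_count_space_finite sum_ennreal s)
  then show ?thesis
    unfolding measure_state_def by (intro pmf_embed_pmf) auto
qed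

lemma sum_bits3:
  fixes f :: "bits3 \<Rightarrow> 'c::comm_monoid_add"
  shows "(\<Sum>b\<in>UNIV. f b) = (\<Sum>b1\<in>UNIV. \<Sum>b2\<in>UNIV. \<Sum>b3\<in>UNIV. f (b1, b2, b3))"
  by (simp add: sum.cartesian_product UNIV_Times_UNIV split_def)

lemma phase_strategy_nth:
  "((hadamard \<otimes> hadamard \<otimes> hadamard) *v
      ((phase_op z1 \<otimes> phase_op z2 \<otimes> phase_op z3) *v ghz)) $ (a1, a2, a3) =
    (1 + (if a1 \<oplus> a2 \<oplus> a3 then - 1 else 1) * (z1 * z2 * z3)) / 4"
proof -
  define r where "r = complex_of_real (sqrt 2)"
  have rr: "r * r = 2" "r \<noteq> 0"
    by (simp_all add: r_def flip: of_real_mult)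
  have r4: "r * (r * (r * r)) = 4"
    by (simp add: rr(1) flip: mult.assoc)
  have g: "ghz $ b = (if b = (False, False, False) \<or> b = (True, True, True) then 1 / r else 0)" for b
    by (auto simp: ghz_def ket_def axis_def r_def scaleR_conv_of_real[where 'a = complex])
  have h: "hadamard $ i $ j = (if i \<and> j then - 1 else 1) / r" for i j
    by (simp add: hadamard_def r_def)
  show ?thesis
    by (cases a1; cases a2; cases a3)
      (simp_all add: g h tensor_op_def phase_op_def matrix_vector_mult_def sum_bits3 UNIV_bool
        r4 mult_ac add_divide_distrib diff_divide_distrib)
qed

lemma final_state_nth:
  "final_state \<epsilon> (x1, x2, x3) $ (a1, a2, a3) =
    (1 + (if a1 \<oplus> a2 \<oplus> a3 then - 1 else 1) *
      cis ((pi / 2 + \<epsilon>) * of_bool x1 + pi / 2 * of_bool x2 + pi / 2 * of_bool x3)) / 4"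
proof -
  have e: "exp (of_real (pi / 2 + \<epsilon>) * \<i> * of_bool x) = cis ((pi / 2 + \<epsilon>) * of_bool x)"
    "exp (of_real pi * \<i> * of_bool x / 2) = cis (pi / 2 * of_bool x)" for x
    by (auto simp: cis_conv_exp mult_ac)
  show ?thesis
    unfolding final_state_def U_err_def U_exact_def e prod.case phase_strategy_nth cis_mult ..
qed

lemma norm_final_state: "norm (final_state \<epsilon> x) = 1"
proof -
  obtain x1 x2 x3 where x: "x = (x1, x2, x3)"
    by (cases x)
  define t where "t = (pi / 2 + \<epsilon>) * of_bool x1 + pi / 2 * of_bool x2 + pi / 2 * of_bool x3"
  have a: "final_state \<epsilon> x $ (a1, a2, a3) = (1 + (if a1 \<oplus> a2 \<oplus> a3 then - 1 else 1) * cis t) / 4"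
    for a1 a2 a3
    by (simp add: x t_def final_state_nth)
  have c: "(cmod (1 + cis t))\<^sup>2 = 2 + 2 * cos t" "(cmod (1 - cis t))\<^sup>2 = 2 - 2 * cos t"
    using sin_cos_squared_add[of t]
    by (simp_all add: cmod_power2 power2_sum power2_diff)
  have "(\<Sum>b\<in>UNIV. (cmod (final_state \<epsilon> x $ b))\<^sup>2) = 1"
    by (simp add: sum_bits3 UNIV_bool a norm_divide power_divide c flip: add_divide_distrib)
  then show ?thesis
    by (simp add: norm_vec_def L2_set_def)
qed

end

theory Submission
  imports Defs
begin

text \<open>The phase steps turn the GHZ state into (|000> + e^(it) |111>)/sqrt 2, where t is the
  sum of the three phases. After the Hadamards the amplitude of an output is (1 + e^(it))/4 or (1 -
  e^(it))/4, according to its parity, so the parity is correct with probability (1 + cos t)/2 or (1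
  - cos t)/2 (\<open>prob_correct_strategy_output\<close>). On the promise t is 0, \<pi>, or \<pi> +
  \<epsilon>, the last exactly when x1 = 1 (\<open>prob_correct_promise\<close>). Averaging over the
  four questions gives the second claim.\<close>

text \<open>Law of total probability, used to condition on the random question.\<close>

lemma measure_bind_pmf:
  "measure_pmf.prob (bind_pmf M f) A = measure_pmf.expectation M (\<lambda>x. measure_pmf.prob (f x) A)"
  using measurable_measure_pmf[of f] unfolding measure_pmf_bind
  by (subst measure_pmf.measure_bind[where N = "count_space UNIV"]) auto

text \<open>Correctness depends only on the output parity, and so does the output probability. The
  promise is not assumed; it only restricts the phase later.\<close>

lemma prob_correct_strategy_output:
  "measure_pmf.prob (strategy_output \<epsilon> (x1, x2, x3)) {a. correct (x1, x2, x3) a} =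
    (1 + (if x1 \<or> x2 \<or> x3 then - 1 else 1) *
      cos ((pi / 2 + \<epsilon>) * of_bool x1 + pi / 2 * of_bool x2 + pi / 2 * of_bool x3)) / 2"
proof -
  define M where "M = strategy_output \<epsilon> (x1, x2, x3)"
  define t where "t = (pi / 2 + \<epsilon>) * of_bool x1 + pi / 2 * of_bool x2 + pi / 2 * of_bool x3"
  have c: "(cmod (1 + cis t))\<^sup>2 = 2 + 2 * cos t" "(cmod (1 - cis t))\<^sup>2 = 2 - 2 * cos t"
    using sin_cos_squared_add[of t]
    by (simp_all add: cmod_power2 power2_sum power2_diff)
  have p: "pmf M (a1, a2, a3) =
      (1 + (if a1 \<oplus> a2 \<oplus> a3 then - 1 else 1) * cos t) / 8" for a1 a2 a3
  proof -
    have "pmf M (a1, a2, a3) =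
        (cmod ((1 + (if a1 \<oplus> a2 \<oplus> a3 then - 1 else 1) * cis t) / 4))\<^sup>2"
      unfolding M_def strategy_output_def pmf_measure_state[OF norm_final_state] final_state_nth t_def ..
    then show ?thesis
      \<comment> \<open>Fixing the parity leaves a single sign, so that \<open>c\<close> applies;
        the 8 is 4^2 / 2.\<close>
      by (cases "a1 \<oplus> a2 \<oplus> a3")
        (simp_all only: if_True if_False, simp_all add: norm_divide power_divide c)
  qed
  have "measure_pmf.prob M {a. correct (x1, x2, x3) a} =
      (\<Sum>a\<in>UNIV. if correct (x1, x2, x3) a then pmf M a else 0)"
    by (simp add: measure_measure_pmf_finite sum.If_cases)
  \<comment> \<open>Four of the eight outputs have the required parity, hence 4/8.\<close>
  also have "\<dots> = (1 + (if x1 \<or> x2 \<or> x3 then - 1 else 1) * cos t) / 2"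
    by (simp add: sum_bits3 UNIV_bool correct_def p)
  finally show ?thesis
    unfolding t_def M_def .
qed

lemma promise_eq:
  "promise = {(False, False, False), (False, True, True), (True, False, True), (True, True, False)}"
  by (auto simp: promise_def)

lemma prob_correct_promise:
  assumes "(x1, x2, x3) \<in> promise"
  shows "measure_pmf.prob (strategy_output \<epsilon> (x1, x2, x3)) {a. correct (x1, x2, x3) a} =
    (if x1 = False then 1 else (1 + cos \<epsilon>) / 2)"
proof -
  \<comment> \<open>If x1 = 1, the promise makes exactly one of x2, x3 equal to 1, so the total
    phase is \<pi> + \<epsilon>.\<close>
  have "pi / 2 + \<epsilon> + pi / 2 = \<epsilon> + pi"
    by (simp add: field_simps)
  then have e: "cos (pi / 2 + \<epsilon> + pi / 2) = - cos \<epsilon>"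
    by (simp only: cos_periodic_pi)
  have "(x1, x2, x3) = (False, False, False) \<or> (x1, x2, x3) = (False, True, True) \<or>
      (x1, x2, x3) = (True, False, True) \<or> (x1, x2, x3) = (True, True, False)"
    using assms by (simp only: promise_eq insert_iff empty_iff simp_thms)
  then show ?thesis
    unfolding prob_correct_strategy_output prod.inject
    \<comment> \<open>The restricted simplification keeps the phase in the shape that
      \<open>e\<close> rewrites.\<close>
    by (elim disjE conjE; hypsubst)
      (simp_all only: of_bool_eq simp_thms if_True if_False mult_1_right mult_zero_right
        add_0_left add_0_right field_sum_of_halves e cos_pi cos_zero, simp_all)
qed

theorem theorem1:
  fixes \<epsilon> :: real
  shows "(\<forall>x1 x2 x3. (x1, x2, x3) \<in> promise \<longrightarrow>
            measure_pmf.prob (strategy_output \<epsilon> (x1, x2, x3)) {a. correct (x1, x2, x3) a} =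
              (if x1 = False then 1 else (1 + cos \<epsilon>) / 2))
       \<and> measure_pmf.prob (random_game \<epsilon>) {(x, a). correct x a} = 1 / 2 + (1 + cos \<epsilon>) / 4"
proof (intro conjI allI impI prob_correct_promise)
  \<comment> \<open>In this form the winning event, given x, pulls back along \<open>Pair x\<close>
    to the correct answers for x.\<close>
  have "random_game \<epsilon> = pmf_of_set promise \<bind> (\<lambda>x. map_pmf (Pair x) (strategy_output \<epsilon> x))"
    by (simp add: random_game_def map_pmf_def)
  then have "measure_pmf.prob (random_game \<epsilon>) {(x, a). correct x a} =
      measure_pmf.expectation (pmf_of_set promise)
        (\<lambda>x. measure_pmf.prob (strategy_output \<epsilon> x) {a. correct x a})"
    by (simp add: measure_bind_pmf vimage_def)
  also have "\<dots> = (\<Sum>x\<in>promise. measure_pmf.prob (strategy_output \<epsilon> x) {a. correct x a}) / 4"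
    by (subst integral_pmf_of_set) (simp_all add: promise_eq)
  \<comment> \<open>Two questions have x1 = 0 and two have x1 = 1.\<close>
  also have "\<dots> = 1 / 2 + (1 + cos \<epsilon>) / 4"
    by (simp add: promise_eq prob_correct_promise)
  finally show "measure_pmf.prob (random_game \<epsilon>) {(x, a). correct x a} =
      1 / 2 + (1 + cos \<epsilon>) / 4" .
qed

end
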